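(* There exist a constant $c>0$ and an integer $n_0$ such that for every integer $n\ge n_0$ there exists a rationalizable data set $T$ over an $n\times n$ strategy space such that every $n\times n$ bimatrix game $(A,B)$ that rationalizes $T$ satisfies $\operatorname{rank}(A+B)\ge c\sqrt{n}$. (That is, the rank of any bimatrix game that rationalizes $T$ is $\Omega(\sqrt n)$.)
   Context: Write $[n]=\{1,\dots,n\}$. An $n\times n$ bimatrix game is a pair $(A,B)$ of real $n\times n$ matrices: $A$ is the payoff matrix of the row player and $B$ that of the column player. The rank of the game is the rank of the matrix $A+B$. A subgame is a pair $(I,J)$ with $I,J\subseteq[n]$. A data set $T$ (over an $n\times n$ strategy space) is a set of triples $((i,j),I,J)$, called observations, where $(I,J)$ is a subgame, $i\in I$ and $j\in J$. A profile $(i,j)\in I\times J$ is a strict (pure) Nash equilibrium of the subgame $(I,J)$ of $(A,B)$ if $A_{ij}>A_{i'j}$ for all $i'\in I\setminus\{i\}$ and $B_{ij}>B_{ij'}$ for all $j'\in J\setminus\{j\}$. The game $(A,B)$ rationalizes $T$ if for every $((i,j),I,J)\in T$ the profile $(i,j)$ is a strict Nash equilibrium of the subgame $(I,J)$. $T$ is rationalizable if some bimatrix game rationalizes it. *)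

theory Defs
  imports "Jordan_Normal_Form.DL_Rank" Complex_Main
begin

(* Strategies are numbered from 0, as matrix entries are: the strategy set
   {1,...,n} is represented by {..<n}. *)

type_synonym profile = "nat \<times> nat"
type_synonym subgame = "nat set \<times> nat set"
type_synonym observation = "profile \<times> subgame"

definition is_data_set :: "nat \<Rightarrow> observation set \<Rightarrow> bool" where
  "is_data_set n T \<longleftrightarrow>
     (\<forall>((i, j), (I, J)) \<in> T. I \<subseteq> {..<n} \<and> J \<subseteq> {..<n} \<and> i \<in> I \<and> j \<in> J)"

definition is_bimatrix_game :: "nat \<Rightarrow> real mat \<Rightarrow> real mat \<Rightarrow> bool" where
  "is_bimatrix_game n A B \<longleftrightarrow> A \<in> carrier_mat n n \<and> B \<in> carrier_mat n n"

definition game_rank :: "nat \<Rightarrow> real mat \<Rightarrow> real mat \<Rightarrow> nat" where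
  "game_rank n A B = vec_space.rank n (A + B)"

definition strict_nash :: "real mat \<Rightarrow> real mat \<Rightarrow> profile \<Rightarrow> subgame \<Rightarrow> bool" where
  "strict_nash A B = (\<lambda>(i, j) (I, J).
     i \<in> I \<and> j \<in> J \<and>
     (\<forall>i' \<in> I - {i}. A $$ (i, j) > A $$ (i', j)) \<and>
     (\<forall>j' \<in> J - {j}. B $$ (i, j) > B $$ (i, j')))"

definition rationalizes :: "real mat \<Rightarrow> real mat \<Rightarrow> observation set \<Rightarrow> bool" where
  "rationalizes A B T \<longleftrightarrow> (\<forall>(p, S) \<in> T. strict_nash A B p S)"

definition rationalizable :: "nat \<Rightarrow> observation set \<Rightarrow> bool" where
  "rationalizable n T \<longleftrightarrow> (\<exists>A B. is_bimatrix_game n A B \<and> rationalizes A B T)"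

end

(* Pair up consecutive strategies, so that the game splits into 2x2 blocks. Declaring both
   diagonal profiles of a block, or both antidiagonal ones, to be strict equilibria prescribes
   the sign of the mixed second difference of A + B on that block, and every sign pattern H of
   the blocks is realizable. The matrix D of mixed differences has rank at most rank (A + B),
   hence rank (A + B) is at least the sign rank of H, and H is taken to be a Hadamard matrix of
   order N with N > n / 4.

   The bound sign rank = Omega (sqrt N) is Forster's, by an elementary argument. If D has rank
   at most r, rescaling the columns of D by suitable positive factors keeps the signs and makes
   every row flat: its sup norm is at most sqrt (8 r / N) times its Euclidean norm. Flat rows
   have a large l1 norm, that is, a large correlation with the rows of H. On the other hand, the
   columns of H are orthogonal, so the correlation of H with normalized rows in an r-dimensional
   space is at most N sqrt r. *)

theory Submission
  imports Defs "HOL-Analysis.Convex"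
begin

section \<open>Orthonormal coordinates for finite-dimensional spaces of functions on a finite
  set\<close>

text \<open>Gram-Schmidt, one function per induction step. The family \<open>f\<close> may be
  linearly dependent on \<open>X\<close>, so \<open>s\<close> is only bounded by
  \<open>card K\<close>.\<close>

lemma orthonormal_family_exists:
  fixes f :: "'k \<Rightarrow> 'x \<Rightarrow> real"
  assumes "finite K" and finX: "finite X"
  shows "\<exists>(s::nat) b. s \<le> card K \<and>
    (\<forall>t<s. \<forall>t'<s. (\<Sum>x\<in>X. b t x * b t' x) = (if t = t' then 1 else 0)) \<and>
    (\<forall>k\<in>K. \<exists>c. \<forall>x\<in>X. f k x = (\<Sum>t<s. c t * b t x))"
  using assms(1)
proof (induction K)
  case empty
  show ?case by (intro exI[of _ 0]) auto
next
  case (insert k K)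
  then obtain s :: nat and b where s: "s \<le> card K"
    and b: "\<And>t t'. t < s \<Longrightarrow> t' < s \<Longrightarrow> (\<Sum>x\<in>X. b t x * b t' x) = (if t = t' then 1 else 0)"
    and f: "\<And>l. l \<in> K \<Longrightarrow> \<exists>c. \<forall>x\<in>X. f l x = (\<Sum>t<s. c t * b t x)"
    by blast
  define c where "c t = (\<Sum>x\<in>X. f k x * b t x)" for t
  \<comment> \<open>The residual of \<open>f k\<close> after orthogonal projection onto the family
    built so far; if it vanishes on \<open>X\<close>, that family already suffices.\<close>
  define g where "g x = f k x - (\<Sum>t<s. c t * b t x)" for x
  have g_orth: "(\<Sum>x\<in>X. g x * b t x) = 0" if t: "t < s" for t
  proof -
    have "(\<Sum>x\<in>X. g x * b t x) = c t - (\<Sum>x\<in>X. \<Sum>t'<s. c t' * (b t' x * b t x))"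
      by (simp add: g_def c_def left_diff_distrib sum_subtractf sum_distrib_right mult.assoc)
    also have "(\<Sum>x\<in>X. \<Sum>t'<s. c t' * (b t' x * b t x)) = (\<Sum>t'<s. c t' * (\<Sum>x\<in>X. b t' x * b t x))"
      by (subst sum.swap) (simp add: sum_distrib_left)
    also have "\<dots> = (\<Sum>t'<s. if t' = t then c t' else 0)"
      by (intro sum.cong refl) (use t b in auto)
    also have "\<dots> = c t" using t by simp
    finally show ?thesis by simp
  qed
  have fk: "f k x = g x + (\<Sum>t<s. c t * b t x)" for x by (simp add: g_def)
  show ?case
  proof (cases "\<forall>x\<in>X. g x = 0")
    case True
    have "\<exists>c. \<forall>x\<in>X. f l x = (\<Sum>t<s. c t * b t x)" if "l \<in> insert k K" for l
      using that True fk f by (cases "l = k") auto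
    moreover have "s \<le> card (insert k K)" using s insert.hyps by simp
    ultimately show ?thesis using b by blast
  next
    case False
    define q where "q = (\<Sum>x\<in>X. (g x)\<^sup>2)"
    have q: "q > 0"
      unfolding q_def using False finX by (auto intro!: sum_pos2)
    define h where "h x = g x / sqrt q" for x
    define b' where "b' t = (if t = s then h else b t)" for t
    have hh: "(\<Sum>x\<in>X. h x * h x) = 1"
      using q by (simp add: h_def q_def power2_eq_square flip: sum_divide_distrib)
    have hb: "(\<Sum>x\<in>X. h x * b t x) = 0" "(\<Sum>x\<in>X. b t x * h x) = 0" if "t < s" for t
      using g_orth[OF that] by (simp_all add: h_def mult.commute[of "b t _"] flip: sum_divide_distrib)
    have orth: "(\<Sum>x\<in>X. b' t x * b' t' x) = (if t = t' then 1 else 0)"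
      if tt: "t < Suc s" "t' < Suc s" for t t'
    proof -
      consider "t = s" "t' = s" | "t = s" "t' < s" | "t < s" "t' = s" | "t < s" "t' < s"
        using tt by linarith
      then show ?thesis
        by cases (simp_all add: b'_def hh hb b)
    qed
    have "\<exists>c. \<forall>x\<in>X. f l x = (\<Sum>t<Suc s. c t * b' t x)" if l: "l \<in> insert k K" for l
    proof -
      \<comment> \<open>One form for the new function (\<open>e = 1\<close>) and the old ones
        (\<open>e = 0\<close>). The coefficient \<open>e * sqrt q\<close> below undoes the
        normalization of \<open>h\<close>.\<close>
      obtain d e where d: "\<And>x. x \<in> X \<Longrightarrow> f l x = e * g x + (\<Sum>t<s. d t * b t x)"
      proof (cases "l = k")
        case True
        then show ?thesis using fk that[of 1 c] by simp
      next
        case False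
        then obtain d where "\<forall>x\<in>X. f l x = (\<Sum>t<s. d t * b t x)" using f[of l] l by blast
        then show ?thesis using that[of 0 d] by simp
      qed
      have "f l x = (\<Sum>t<Suc s. (d(s := e * sqrt q)) t * b' t x)" if "x \<in> X" for x
        using d[OF that] q by (simp add: b'_def h_def)
      then show ?thesis by blast
    qed
    moreover have "Suc s \<le> card (insert k K)" using s insert.hyps by simp
    ultimately show ?thesis using orth by (intro exI[of _ "Suc s"] exI[of _ b']) blast
  qed
qed

lemma sum_square_orthonormal:
  fixes b :: "nat \<Rightarrow> 'x \<Rightarrow> real"
  assumes b: "\<And>t t'. t < s \<Longrightarrow> t' < s \<Longrightarrow> (\<Sum>x\<in>X. b t x * b t' x) = (if t = t' then 1 else 0)"
    and g: "\<And>x. x \<in> X \<Longrightarrow> g x = (\<Sum>t<s. c t * b t x)"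
  shows "(\<Sum>x\<in>X. (g x)\<^sup>2) = (\<Sum>t<s. (c t)\<^sup>2)"
proof -
  have "(\<Sum>x\<in>X. (g x)\<^sup>2) = (\<Sum>x\<in>X. \<Sum>t<s. \<Sum>t'<s. c t * c t' * (b t x * b t' x))"
    by (intro sum.cong refl) (simp add: g power2_eq_square sum_product mult_ac)
  also have "\<dots> = (\<Sum>t<s. \<Sum>x\<in>X. \<Sum>t'<s. c t * c t' * (b t x * b t' x))"
    by (rule sum.swap)
  also have "\<dots> = (\<Sum>t<s. \<Sum>t'<s. \<Sum>x\<in>X. c t * c t' * (b t x * b t' x))"
    by (rule sum.cong[OF refl], rule sum.swap)
  also have "\<dots> = (\<Sum>t<s. \<Sum>t'<s. if t' = t then (c t)\<^sup>2 else 0)"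
    by (intro sum.cong refl) (auto simp: b power2_eq_square simp flip: sum_distrib_left)
  also have "\<dots> = (\<Sum>t<s. (c t)\<^sup>2)" by simp
  finally show ?thesis .
qed


text \<open>A single family \<open>b\<close> serves all coefficient vectors \<open>a\<close>, and
  passing to coordinates preserves the norm. Estimates on the span thus become Cauchy-Schwarz in at
  most \<open>card K\<close> coordinates.\<close>

lemma orthonormal_coordinates:
  fixes f :: "'k \<Rightarrow> 'x \<Rightarrow> real"
  assumes "finite K" "finite X"
  obtains s :: nat and b where "s \<le> card K"
    and "\<And>t t'. t < s \<Longrightarrow> t' < s \<Longrightarrow> (\<Sum>x\<in>X. b t x * b t' x) = (if t = t' then 1 else 0)"
    and "\<And>a. \<exists>c. (\<forall>x\<in>X. (\<Sum>k\<in>K. a k * f k x) = (\<Sum>t<s. c t * b t x)) \<and>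
           (\<Sum>x\<in>X. (\<Sum>k\<in>K. a k * f k x)\<^sup>2) = (\<Sum>t<s. (c t)\<^sup>2)"
proof -
  obtain s :: nat and b where s: "s \<le> card K"
    and b: "\<And>t t'. t < s \<Longrightarrow> t' < s \<Longrightarrow> (\<Sum>x\<in>X. b t x * b t' x) = (if t = t' then 1 else 0)"
    and "\<forall>k\<in>K. \<exists>d. \<forall>x\<in>X. f k x = (\<Sum>t<s. d t * b t x)"
    using orthonormal_family_exists[OF assms, of f] by blast
  then obtain d where d: "\<And>k x. k \<in> K \<Longrightarrow> x \<in> X \<Longrightarrow> f k x = (\<Sum>t<s. d k t * b t x)"
    by metis
  have "\<exists>c. (\<forall>x\<in>X. (\<Sum>k\<in>K. a k * f k x) = (\<Sum>t<s. c t * b t x)) \<and>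
           (\<Sum>x\<in>X. (\<Sum>k\<in>K. a k * f k x)\<^sup>2) = (\<Sum>t<s. (c t)\<^sup>2)" for a
  proof -
    define c where "c t = (\<Sum>k\<in>K. a k * d k t)" for t
    have c: "(\<Sum>k\<in>K. a k * f k x) = (\<Sum>t<s. c t * b t x)" if "x \<in> X" for x
    proof -
      have "(\<Sum>k\<in>K. a k * f k x) = (\<Sum>k\<in>K. \<Sum>t<s. a k * d k t * b t x)"
        by (intro sum.cong refl) (simp add: d that sum_distrib_left mult.assoc)
      also have "\<dots> = (\<Sum>t<s. c t * b t x)"
        by (subst sum.swap) (simp add: c_def sum_distrib_right)
      finally show ?thesis .
    qed
    show ?thesis
      using c sum_square_orthonormal[where g = "\<lambda>x. \<Sum>k\<in>K. a k * f k x" and c = c, OF b c] by blast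
  qed
  then show ?thesis using s b that by blast
qed

section \<open>Estimates in the span of few functions: peaks, correlation, flattening\<close>

text \<open>A trace argument. The sum of \<open>(b t j)\<^sup>2\<close> over \<open>t\<close> is the
  diagonal entry at \<open>j\<close> of the orthogonal projection onto the span. By Cauchy-Schwarz a
  peak at \<open>j\<close> makes this entry at least \<open>u\<close>, while the trace is
  \<open>s\<close>, hence at most \<open>card K\<close>.\<close>

lemma card_peaks_le:
  fixes f :: "'k \<Rightarrow> 'x \<Rightarrow> real" and u :: real
  assumes fin: "finite K" "finite X" and J: "J \<subseteq> X"
    and peak: "\<And>j. j \<in> J \<Longrightarrow> \<exists>a. 0 < (\<Sum>x\<in>X. (\<Sum>k\<in>K. a k * f k x)\<^sup>2) \<and>
          u * (\<Sum>x\<in>X. (\<Sum>k\<in>K. a k * f k x)\<^sup>2) \<le> (\<Sum>k\<in>K. a k * f k j)\<^sup>2"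
  shows "u * card J \<le> card K"
proof -
  obtain s :: nat and b where s: "s \<le> card K"
    and b: "\<And>t t'. t < s \<Longrightarrow> t' < s \<Longrightarrow> (\<Sum>x\<in>X. b t x * b t' x) = (if t = t' then 1 else 0)"
    and co: "\<And>a. \<exists>c. (\<forall>x\<in>X. (\<Sum>k\<in>K. a k * f k x) = (\<Sum>t<s. c t * b t x)) \<and>
           (\<Sum>x\<in>X. (\<Sum>k\<in>K. a k * f k x)\<^sup>2) = (\<Sum>t<s. (c t)\<^sup>2)"
    using orthonormal_coordinates[OF fin, of f] by blast
  have u: "u \<le> (\<Sum>t<s. (b t j)\<^sup>2)" if j: "j \<in> J" for j
  proof -
    obtain a where a: "0 < (\<Sum>x\<in>X. (\<Sum>k\<in>K. a k * f k x)\<^sup>2)"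
      "u * (\<Sum>x\<in>X. (\<Sum>k\<in>K. a k * f k x)\<^sup>2) \<le> (\<Sum>k\<in>K. a k * f k j)\<^sup>2"
      using peak[OF j] by blast
    obtain c where c: "(\<Sum>k\<in>K. a k * f k j) = (\<Sum>t<s. c t * b t j)"
      "(\<Sum>x\<in>X. (\<Sum>k\<in>K. a k * f k x)\<^sup>2) = (\<Sum>t<s. (c t)\<^sup>2)"
      using co[of a] j J by blast
    have "(\<Sum>t<s. c t * b t j)\<^sup>2 \<le> (\<Sum>t<s. (c t)\<^sup>2) * (\<Sum>t<s. (b t j)\<^sup>2)"
      by (rule Cauchy_Schwarz_ineq_sum)
    with a(2) have "u * (\<Sum>t<s. (c t)\<^sup>2) \<le> (\<Sum>t<s. (b t j)\<^sup>2) * (\<Sum>t<s. (c t)\<^sup>2)"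
      unfolding c by (simp only: mult.commute)
    then show ?thesis using a(1) c(2) mult_right_le_imp_le by metis
  qed
  have "u * card J = (\<Sum>j\<in>J. u)" by simp
  also have "\<dots> \<le> (\<Sum>j\<in>J. \<Sum>t<s. (b t j)\<^sup>2)" using u by (rule sum_mono)
  also have "\<dots> \<le> (\<Sum>j\<in>X. \<Sum>t<s. (b t j)\<^sup>2)"
    using J fin by (intro sum_mono2) (auto intro: sum_nonneg)
  also have "\<dots> = (\<Sum>t<s. \<Sum>j\<in>X. b t j * b t j)"
    by (subst sum.swap) (simp add: power2_eq_square)
  also have "\<dots> = s" using b by simp
  finally show ?thesis using s by simp
qed

text \<open>In coordinates the correlation is the inner product of the arrays \<open>c\<close> and
  \<open>B\<close> over \<open>M\<close> and the basis indices. The rows of \<open>c\<close> are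
  unit vectors, and each column of \<open>B\<close> has squared norm \<open>h\<close>, because
  \<open>H\<close> multiplies all squared norms by \<open>h\<close>. Cauchy-Schwarz on the whole
  arrays gives the bound.\<close>

lemma correlation_with_span_le:
  fixes f :: "'k \<Rightarrow> 'x \<Rightarrow> real" and H :: "'i \<Rightarrow> 'x \<Rightarrow> real" and h :: real
  assumes fin: "finite K" "finite X" "finite M"
    and H: "\<And>x y. x \<in> X \<Longrightarrow> y \<in> X \<Longrightarrow> (\<Sum>i\<in>M. H i x * H i y) = (if x = y then h else 0)"
    and h: "h \<ge> 0"
    and norm: "\<And>i. i \<in> M \<Longrightarrow> (\<Sum>x\<in>X. (\<Sum>k\<in>K. a i k * f k x)\<^sup>2) = 1"
  shows "(\<Sum>i\<in>M. \<Sum>x\<in>X. H i x * (\<Sum>k\<in>K. a i k * f k x))\<^sup>2 \<le> card M * (h * card K)"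
proof -
  obtain s :: nat and b where s: "s \<le> card K"
    and b: "\<And>t t'. t < s \<Longrightarrow> t' < s \<Longrightarrow> (\<Sum>x\<in>X. b t x * b t' x) = (if t = t' then 1 else 0)"
    and co: "\<And>a. \<exists>c. (\<forall>x\<in>X. (\<Sum>k\<in>K. a k * f k x) = (\<Sum>t<s. c t * b t x)) \<and>
           (\<Sum>x\<in>X. (\<Sum>k\<in>K. a k * f k x)\<^sup>2) = (\<Sum>t<s. (c t)\<^sup>2)"
    using orthonormal_coordinates[OF fin(1,2), of f] by blast
  obtain c where c: "\<And>i x. x \<in> X \<Longrightarrow> (\<Sum>k\<in>K. a i k * f k x) = (\<Sum>t<s. c i t * b t x)"
    and c1: "\<And>i. i \<in> M \<Longrightarrow> (\<Sum>t<s. (c i t)\<^sup>2) = 1"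
  proof -
    have "\<forall>i. \<exists>c. (\<forall>x\<in>X. (\<Sum>k\<in>K. a i k * f k x) = (\<Sum>t<s. c t * b t x)) \<and>
           (\<Sum>x\<in>X. (\<Sum>k\<in>K. a i k * f k x)\<^sup>2) = (\<Sum>t<s. (c t)\<^sup>2)"
      using co by blast
    then obtain c where "\<forall>i. (\<forall>x\<in>X. (\<Sum>k\<in>K. a i k * f k x) = (\<Sum>t<s. c i t * b t x)) \<and>
           (\<Sum>x\<in>X. (\<Sum>k\<in>K. a i k * f k x)\<^sup>2) = (\<Sum>t<s. (c i t)\<^sup>2)"
      by (rule choice[THEN exE])
    then show ?thesis by (intro that[of c]) (auto, metis norm)
  qed
  define B where "B i t = (\<Sum>x\<in>X. H i x * b t x)" for i t
  have BB: "(\<Sum>i\<in>M. (B i t)\<^sup>2) = h" if t: "t < s" for t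
  proof -
    have "(\<Sum>i\<in>M. (B i t)\<^sup>2) = (\<Sum>i\<in>M. \<Sum>x\<in>X. \<Sum>y\<in>X. b t x * b t y * (H i x * H i y))"
      by (simp add: B_def power2_eq_square sum_product mult_ac)
    also have "\<dots> = (\<Sum>x\<in>X. \<Sum>i\<in>M. \<Sum>y\<in>X. b t x * b t y * (H i x * H i y))"
      by (rule sum.swap)
    also have "\<dots> = (\<Sum>x\<in>X. \<Sum>y\<in>X. \<Sum>i\<in>M. b t x * b t y * (H i x * H i y))"
      by (rule sum.cong[OF refl], rule sum.swap)
    also have "\<dots> = (\<Sum>x\<in>X. \<Sum>y\<in>X. if y = x then h * (b t x * b t x) else 0)"
      by (intro sum.cong refl) (auto simp: H simp flip: sum_distrib_left)
    also have "\<dots> = h * (\<Sum>x\<in>X. b t x * b t x)"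
      using fin by (simp add: sum_distrib_left)
    finally show ?thesis using b[OF t t] by simp
  qed
  have "(\<Sum>i\<in>M. \<Sum>x\<in>X. H i x * (\<Sum>k\<in>K. a i k * f k x)) =
      (\<Sum>i\<in>M. \<Sum>x\<in>X. \<Sum>t<s. c i t * (H i x * b t x))"
    by (intro sum.cong refl) (simp add: c sum_distrib_left mult_ac)
  also have "\<dots> = (\<Sum>i\<in>M. \<Sum>t<s. \<Sum>x\<in>X. c i t * (H i x * b t x))"
    by (rule sum.cong[OF refl], rule sum.swap)
  also have "\<dots> = (\<Sum>(i, t)\<in>M \<times> {..<s}. c i t * B i t)"
    by (simp add: B_def sum.cartesian_product flip: sum_distrib_left)
  finally have "(\<Sum>i\<in>M. \<Sum>x\<in>X. H i x * (\<Sum>k\<in>K. a i k * f k x))\<^sup>2 =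
      (\<Sum>p\<in>M \<times> {..<s}. c (fst p) (snd p) * B (fst p) (snd p))\<^sup>2"
    by (simp add: case_prod_unfold)
  also have "\<dots> \<le> (\<Sum>p\<in>M \<times> {..<s}. (c (fst p) (snd p))\<^sup>2) * (\<Sum>p\<in>M \<times> {..<s}. (B (fst p) (snd p))\<^sup>2)"
    by (rule Cauchy_Schwarz_ineq_sum)
  also have "(\<Sum>p\<in>M \<times> {..<s}. (c (fst p) (snd p))\<^sup>2) = (\<Sum>i\<in>M. \<Sum>t<s. (c i t)\<^sup>2)"
    by (simp add: sum.cartesian_product case_prod_unfold)
  also have "\<dots> = card M" by (simp add: c1)
  also have "(\<Sum>p\<in>M \<times> {..<s}. (B (fst p) (snd p))\<^sup>2) = (\<Sum>i\<in>M. \<Sum>t<s. (B i t)\<^sup>2)"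
    by (simp add: sum.cartesian_product case_prod_unfold)
  also have "\<dots> = (\<Sum>t<s. \<Sum>i\<in>M. (B i t)\<^sup>2)" by (rule sum.swap)
  also have "\<dots> = h * s" by (simp add: BB)
  also have "card M * (h * s) \<le> card M * (h * card K)"
    using s h by (intro mult_left_mono) auto
  finally show ?thesis .
qed

text \<open>
  The weights are powers of 1/2. Start with all weights 1 and keep halving the weight of a
  coordinate on which some vector of the span is not flat. Each halved coordinate retains a peak
  of relative size at least u, so by \<open>card_peaks_le\<close> some coordinate is never halved. The
  regularization by \<open>\<delta>\<close> bounds the number of halvings, so that no general position
  assumption on the span is needed.
\<close>

lemma flattening_weights:
  fixes f :: "'k \<Rightarrow> 'x \<Rightarrow> real" and u \<delta> :: real
  assumes fin: "finite K" "finite X" and u: "u > 0" and \<delta>: "\<delta> > 0"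
    and large: "u * card X > card K"
  defines "L \<equiv> (\<lambda>a x. \<Sum>k\<in>K. a k * f k x)"
  obtains w :: "'x \<Rightarrow> real" where "\<And>x. 0 < w x" "\<exists>x\<in>X. w x = 1"
    "\<And>a x. x \<in> X \<Longrightarrow> w x * (L a x)\<^sup>2 \<le> 2 * u * ((\<Sum>y\<in>X. w y * (L a y)\<^sup>2) + \<delta> * (\<Sum>y\<in>X. (L a y)\<^sup>2))"
proof -
  define W where "W p x = (1/2::real) ^ p x" for p :: "'x \<Rightarrow> nat" and x
  define R where "R p a = (\<Sum>y\<in>X. W p y * (L a y)\<^sup>2) + \<delta> * (\<Sum>y\<in>X. (L a y)\<^sup>2)" for p a
  \<comment> \<open>\<open>p x\<close> counts the halvings at \<open>x\<close>. Every halved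
    coordinate must still carry a witness of its peak with respect to the current weights, not those
    at the time of halving.\<close>
  define adm where "adm p \<longleftrightarrow> (\<forall>x\<in>X. p x = 0 \<or>
     (\<exists>a. 0 < (\<Sum>y\<in>X. (L a y)\<^sup>2) \<and> u * R p a \<le> W p x * (L a x)\<^sup>2))" for p
  have Wpos: "W p x > 0" for p x by (simp add: W_def)
  \<comment> \<open>A peak at \<open>x\<close> forces \<open>W p x\<close> to be at least
    \<open>u * \<delta>\<close>, since \<open>R p a\<close> contains the regularizing term; so fewer
    than \<open>b\<close> halvings can occur there.\<close>
  obtain b :: nat where b: "(1/2::real) ^ b < u * \<delta>"
    using real_arch_pow_inv[of "u * \<delta>" "1/2"] u \<delta> by auto
  have bound: "p x < b" if p: "adm p" "x \<in> X" "p x \<noteq> 0" for p x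
  proof -
    obtain a where a: "0 < (\<Sum>y\<in>X. (L a y)\<^sup>2)" "u * R p a \<le> W p x * (L a x)\<^sup>2"
      using p unfolding adm_def by fastforce
    define Q where "Q = (\<Sum>y\<in>X. (L a y)\<^sup>2)"
    have "\<delta> * Q \<le> R p a"
      unfolding R_def Q_def using Wpos by (simp add: sum_nonneg less_imp_le)
    then have "u * (\<delta> * Q) \<le> W p x * (L a x)\<^sup>2"
      using a(2) u by (meson mult_left_mono less_imp_le order_trans)
    also have "\<dots> \<le> W p x * Q"
      using fin p Wpos unfolding Q_def by (intro mult_left_mono member_le_sum) (auto simp: less_imp_le)
    finally have "u * \<delta> \<le> W p x"
      using a(1) mult_right_le_imp_le[of "u * \<delta>" Q "W p x"] by (simp add: Q_def mult.assoc)
    with b have "(1/2::real) ^ b < (1/2) ^ p x" unfolding W_def by (rule less_le_trans)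
    moreover have "(1/2::real) ^ p x \<le> (1/2) ^ b" if "b \<le> p x"
      using that by (rule power_decreasing) auto
    ultimately show ?thesis by linarith
  qed
  have "adm (\<lambda>_. 0)" by (simp add: adm_def)
  moreover have "\<forall>p. adm p \<longrightarrow> sum p X < Suc (card X * b)"
  proof (intro allI impI)
    fix p assume "adm p"
    then have "p x \<le> b" if "x \<in> X" for x using bound[of p x] that by (cases "p x = 0") auto
    then have "sum p X \<le> (\<Sum>x\<in>X. b)" by (rule sum_mono)
    then show "sum p X < Suc (card X * b)" by simp
  qed
  ultimately obtain p where p: "adm p" and p_max: "\<And>q. adm q \<Longrightarrow> sum q X \<le> sum p X"
    using ex_has_greatest_nat[of adm "\<lambda>_. 0" "\<lambda>p. sum p X"] by blast
  \<comment> \<open>Otherwise \<open>x\<close> could be halved once more, against maximality of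
    \<open>p\<close>. The factor 2 absorbs the halving at \<open>x\<close>; elsewhere the old
    witnesses survive, as \<open>R\<close> does not increase and the weight there is
    unchanged.\<close>
  have flat: "W p x * (L a x)\<^sup>2 \<le> 2 * u * R p a" if x: "x \<in> X" for a x
  proof (rule ccontr)
    assume *: "\<not> ?thesis"
    define q where "q = p(x := Suc (p x))"
    have Wq: "W q y = (if y = x then W p y / 2 else W p y)" for y by (simp add: W_def q_def)
    have Rq: "R q c \<le> R p c" for c
      unfolding R_def using Wpos by (auto intro!: sum_mono mult_right_mono simp: Wq less_imp_le)
    have uRq: "u * R q c \<le> u * R p c" for c using Rq u by simp
    have Rpos: "R p a \<ge> 0"
      unfolding R_def using Wpos \<delta> by (intro add_nonneg_nonneg sum_nonneg mult_nonneg_nonneg) (auto simp: less_imp_le)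
    have "L a x \<noteq> 0" using * Rpos u by auto
    then have pos: "0 < (\<Sum>y\<in>X. (L a y)\<^sup>2)" using x fin by (intro sum_pos2[of _ x]) auto
    have "\<exists>a. 0 < (\<Sum>y\<in>X. (L a y)\<^sup>2) \<and> u * R q a \<le> W q x * (L a x)\<^sup>2"
      using * uRq[of a] pos by (intro exI[of _ a]) (auto simp: Wq)
    moreover have "q y = 0 \<or> (\<exists>a. 0 < (\<Sum>y\<in>X. (L a y)\<^sup>2) \<and> u * R q a \<le> W q y * (L a y)\<^sup>2)"
      if y: "y \<in> X" "y \<noteq> x" for y
    proof (cases "p y = 0")
      case False
      then obtain c where "0 < (\<Sum>y\<in>X. (L c y)\<^sup>2)" "u * R p c \<le> W p y * (L c y)\<^sup>2"
        using p y unfolding adm_def by fastforce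
      then show ?thesis using uRq[of c] y by (intro disjI2 exI[of _ c]) (simp add: Wq)
    qed (use y in \<open>simp add: q_def\<close>)
    ultimately have "adm q" unfolding adm_def by blast
    moreover have "sum q X = Suc (sum p X)"
      using x fin by (simp add: q_def sum.remove[of X x] sum.If_cases Diff_eq)
    ultimately show False using p_max[of q] by simp
  qed
  have "\<exists>x\<in>X. p x = 0"
  proof (rule ccontr)
    assume "\<not> ?thesis"
    then have nz: "p x \<noteq> 0" if "x \<in> X" for x using that by auto
    have "u * card X \<le> card K"
    \<comment> \<open>If all coordinates had been halved, all would be peaks of the span rescaled by
      the square roots of the weights, contradicting \<open>large\<close>.\<close>
    proof (rule card_peaks_le[OF fin order_refl, of "\<lambda>k x. sqrt (W p x) * f k x"])
      fix j assume j: "j \<in> X"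
      have sq: "(\<Sum>k\<in>K. a k * (sqrt (W p x) * f k x))\<^sup>2 = W p x * (L a x)\<^sup>2" for a x
      proof -
        have "(\<Sum>k\<in>K. a k * (sqrt (W p x) * f k x)) = sqrt (W p x) * L a x"
          by (simp add: L_def sum_distrib_left mult_ac)
        then show ?thesis using Wpos[of p x] by (simp add: power_mult_distrib)
      qed
      obtain a where a: "0 < (\<Sum>y\<in>X. (L a y)\<^sup>2)" "u * R p a \<le> W p j * (L a j)\<^sup>2"
        using p nz[OF j] j unfolding adm_def by fastforce
      have "u * (\<Sum>y\<in>X. W p y * (L a y)\<^sup>2) \<le> u * R p a"
        unfolding R_def using u \<delta> a(1) by simp
      moreover have "0 < (\<Sum>y\<in>X. W p y * (L a y)\<^sup>2)"
      proof -
        have "\<not> (\<forall>y\<in>X. L a y = 0)"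
        proof
          assume "\<forall>y\<in>X. L a y = 0"
          then have "(\<Sum>y\<in>X. (L a y)\<^sup>2) = 0" by (simp add: sum.neutral)
          with a(1) show False by simp
        qed
        then obtain y where "y \<in> X" "L a y \<noteq> 0" by auto
        then show ?thesis using fin Wpos by (intro sum_pos2[of _ y]) (auto simp: less_imp_le)
      qed
      ultimately show "\<exists>a. 0 < (\<Sum>x\<in>X. (\<Sum>k\<in>K. a k * (sqrt (W p x) * f k x))\<^sup>2) \<and>
          u * (\<Sum>x\<in>X. (\<Sum>k\<in>K. a k * (sqrt (W p x) * f k x))\<^sup>2) \<le> (\<Sum>k\<in>K. a k * (sqrt (W p j) * f k j))\<^sup>2"
        using a by (intro exI[of _ a]) (simp add: sq)
    qed
    with large show False by simp
  qed
  then have "\<exists>x\<in>X. W p x = 1" unfolding W_def by (metis power_0)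
  then show ?thesis using that[of "W p"] Wpos flat unfolding R_def by blast
qed


section \<open>Forster's lower bound on the sign rank\<close>

text \<open>The flattened unit rows \<open>g i\<close> have entries at most
  \<open>sqrt (4 * u)\<close>. Their total correlation with \<open>H\<close> is therefore at least
  \<open>card M / sqrt (4 * u)\<close>, but at most \<open>card M * sqrt (card K)\<close>. Comparing
  the two gives \<open>1 \<le> 4 * u * card K\<close>, where \<open>u\<close> is proportional to
  \<open>card K / card X\<close>.\<close>

lemma sign_rank_bound:
  fixes f :: "'k \<Rightarrow> 'x \<Rightarrow> real" and H :: "'i \<Rightarrow> 'x \<Rightarrow> real"
  assumes fin: "finite K" "finite X" "finite M" and M: "M \<noteq> {}"
    and H1: "\<And>i x. i \<in> M \<Longrightarrow> x \<in> X \<Longrightarrow> \<bar>H i x\<bar> = 1"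
    and H_orth: "\<And>x y. x \<in> X \<Longrightarrow> y \<in> X \<Longrightarrow> x \<noteq> y \<Longrightarrow> (\<Sum>i\<in>M. H i x * H i y) = 0"
    and sgn: "\<And>i x. i \<in> M \<Longrightarrow> x \<in> X \<Longrightarrow> 0 < H i x * (\<Sum>k\<in>K. a i k * f k x)"
  shows "card X \<le> 8 * (card K)\<^sup>2"
proof (cases "X = {}")
  case False
  define D where "D i x = (\<Sum>k\<in>K. a i k * f k x)" for i x
  have D0: "D i x \<noteq> 0" if "i \<in> M" "x \<in> X" for i x using sgn[OF that] by (auto simp: D_def)
  have "K \<noteq> {}" using D0 M False by (auto simp: D_def)
  then have r: "card K > 0" using fin by (simp add: card_gt_0_iff)
  have N: "card X > 0" using False fin by (simp add: card_gt_0_iff)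
  \<comment> \<open>The factor 2 serves to make the inequality \<open>large\<close> strict.\<close>
  define u where "u = 2 * real (card K) / card X"
  have u: "u > 0" using r N by (simp add: u_def)
  have large: "u * card X > card K" using r N by (simp add: u_def)
  text \<open>So small that the regularization is negligible for the rows of \<open>D\<close>, as some weight is 1.\<close>
  define \<delta> where "\<delta> = Min ((\<lambda>(i, x). (D i x)\<^sup>2 / (\<Sum>y\<in>X. (D i y)\<^sup>2)) ` (M \<times> X))"
  have Dpos: "0 < (\<Sum>y\<in>X. (D i y)\<^sup>2)" if "i \<in> M" for i
    using that D0 False fin by (intro sum_pos) auto
  have \<delta>: "\<delta> > 0"
    unfolding \<delta>_def using fin False M D0 Dpos by (subst Min_gr_iff) auto
  have \<delta>_le: "\<delta> * (\<Sum>y\<in>X. (D i y)\<^sup>2) \<le> (D i x)\<^sup>2" if "i \<in> M" "x \<in> X" for i x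
  proof -
    have "\<delta> \<le> (D i x)\<^sup>2 / (\<Sum>y\<in>X. (D i y)\<^sup>2)"
      unfolding \<delta>_def using fin that by (intro Min_le) auto
    then show ?thesis using Dpos[OF that(1)] by (simp add: pos_le_divide_eq)
  qed
  obtain w :: "'x \<Rightarrow> real" where w: "\<And>x. 0 < w x" and w1: "\<exists>x\<in>X. w x = 1"
    and flat: "\<And>a x. x \<in> X \<Longrightarrow> w x * (\<Sum>k\<in>K. a k * f k x)\<^sup>2 \<le>
        2 * u * ((\<Sum>y\<in>X. w y * (\<Sum>k\<in>K. a k * f k y)\<^sup>2) + \<delta> * (\<Sum>y\<in>X. (\<Sum>k\<in>K. a k * f k y)\<^sup>2))"
    using flattening_weights[OF fin(1,2) u \<delta> large, of f] by blast
  define E where "E i = (\<Sum>y\<in>X. w y * (D i y)\<^sup>2)" for i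
  have E: "E i > 0" if "i \<in> M" for i
    unfolding E_def using that D0 w False fin by (intro sum_pos) auto
  define g where "g i x = sqrt (w x) * D i x / sqrt (E i)" for i x
  have g_sq: "(g i x)\<^sup>2 = w x * (D i x)\<^sup>2 / E i" if "i \<in> M" for i x
    using w[of x] E[OF that] by (simp add: g_def power_mult_distrib power_divide)
  have g1: "(\<Sum>x\<in>X. (g i x)\<^sup>2) = 1" if "i \<in> M" for i
    using E[OF that] by (simp add: g_sq that E_def flip: sum_divide_distrib)
  have g_small: "\<bar>g i x\<bar> \<le> sqrt (4 * u)" if i: "i \<in> M" and x: "x \<in> X" for i x
  proof -
    obtain z where z: "z \<in> X" "w z = 1" using w1 by blast
    have "\<delta> * (\<Sum>y\<in>X. (D i y)\<^sup>2) \<le> w z * (D i z)\<^sup>2" using \<delta>_le i z by simp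
    also have "\<dots> \<le> E i"
      unfolding E_def using z fin w by (intro member_le_sum) (auto simp: less_imp_le)
    \<comment> \<open>The regularization at most doubles the bracket, which turns the flatness
      constant \<open>2 * u\<close> into \<open>4 * u\<close>.\<close>
    finally have "2 * u * (E i + \<delta> * (\<Sum>y\<in>X. (D i y)\<^sup>2)) \<le> 2 * u * (E i + E i)"
      using u by simp
    moreover have "w x * (D i x)\<^sup>2 \<le> 2 * u * (E i + \<delta> * (\<Sum>y\<in>X. (D i y)\<^sup>2))"
      using flat[OF x] unfolding D_def E_def .
    ultimately have "w x * (D i x)\<^sup>2 \<le> 4 * u * E i" by simp
    then have "(g i x)\<^sup>2 \<le> 4 * u" using E[OF i] by (simp add: g_sq[OF i] pos_divide_le_eq)
    then show ?thesis by (metis real_sqrt_abs real_sqrt_le_iff)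
  qed
  \<comment> \<open>Since signs agree, the correlation is the l1 norm of \<open>g i\<close>; a unit
    vector satisfies 1 \<le> (sup norm) * (l1 norm).\<close>
  have corr: "1 \<le> sqrt (4 * u) * (\<Sum>x\<in>X. H i x * g i x)" if i: "i \<in> M" for i
  proof -
    have "H i x * g i x = \<bar>g i x\<bar>" if x: "x \<in> X" for x
    proof -
      have "0 < H i x * D i x" using sgn[OF i x] by (simp add: D_def)
      then have "0 \<le> H i x * D i x * (sqrt (w x) / sqrt (E i))"
        using w[of x] E[OF i] by simp
      then have "0 \<le> H i x * g i x" by (simp add: g_def mult_ac)
      then have "H i x * g i x = \<bar>H i x * g i x\<bar>" by simp
      then show ?thesis using H1[OF i x] by (simp add: abs_mult)
    qed
    then have H_abs: "(\<Sum>x\<in>X. H i x * g i x) = (\<Sum>x\<in>X. \<bar>g i x\<bar>)" by simp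
    have "1 = (\<Sum>x\<in>X. \<bar>g i x\<bar> * \<bar>g i x\<bar>)" using g1[OF i] by (simp add: power2_eq_square)
    also have "\<dots> \<le> (\<Sum>x\<in>X. sqrt (4 * u) * \<bar>g i x\<bar>)"
      using g_small[OF i] by (intro sum_mono mult_right_mono) auto
    finally show ?thesis by (simp add: H_abs sum_distrib_left)
  qed
  \<comment> \<open>Scaling rows and columns keeps the rows in a span of \<open>card K\<close>
    functions.\<close>
  have g_span: "g i x = (\<Sum>k\<in>K. (a i k / sqrt (E i)) * (sqrt (w x) * f k x))" for i x
    by (simp add: g_def D_def sum_distrib_left sum_divide_distrib mult_ac)
  have "(\<Sum>i\<in>M. \<Sum>x\<in>X. H i x * g i x)\<^sup>2 \<le> card M * (real (card M) * card K)"
    unfolding g_span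
  proof (rule correlation_with_span_le[OF fin, where f = "\<lambda>k x. sqrt (w x) * f k x"
        and a = "\<lambda>i k. a i k / sqrt (E i)"])
    fix x y assume xy: "x \<in> X" "y \<in> X"
    have "(\<Sum>i\<in>M. H i x * H i x) = (\<Sum>i\<in>M. 1)"
      using H1 xy by (intro sum.cong refl) (metis abs_mult_self_eq mult_1)
    then show "(\<Sum>i\<in>M. H i x * H i y) = (if x = y then real (card M) else 0)"
      using H_orth[OF xy] by (cases "x = y") simp_all
  qed (use g1 in \<open>simp_all add: g_span\<close>)
  then have upper: "(\<Sum>i\<in>M. \<Sum>x\<in>X. H i x * g i x)\<^sup>2 \<le> (real (card M))\<^sup>2 * card K"
    by (simp add: power2_eq_square mult.assoc)
  have "real (card M) = (\<Sum>i\<in>M. 1)" by simp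
  also have "\<dots> \<le> (\<Sum>i\<in>M. sqrt (4 * u) * (\<Sum>x\<in>X. H i x * g i x))"
    using corr by (rule sum_mono)
  also have "\<dots> = sqrt (4 * u) * (\<Sum>i\<in>M. \<Sum>x\<in>X. H i x * g i x)"
    by (simp add: sum_distrib_left)
  finally have "(real (card M))\<^sup>2 \<le> (sqrt (4 * u) * (\<Sum>i\<in>M. \<Sum>x\<in>X. H i x * g i x))\<^sup>2"
    by (intro power_mono) auto
  also have "\<dots> = 4 * u * (\<Sum>i\<in>M. \<Sum>x\<in>X. H i x * g i x)\<^sup>2"
    using u by (simp add: power_mult_distrib)
  also have "\<dots> \<le> 4 * u * ((real (card M))\<^sup>2 * card K)"
    using upper u by (intro mult_left_mono) auto
  finally have "(real (card M))\<^sup>2 * 1 \<le> (real (card M))\<^sup>2 * (4 * u * card K)"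
    by (simp add: mult_ac)
  moreover have "0 < (real (card M))\<^sup>2" using M fin by (simp add: card_gt_0_iff)
  ultimately have "1 \<le> 4 * u * card K" by (simp only: mult_le_cancel_left_pos)
  then have "real (card X) \<le> 8 * (real (card K))\<^sup>2"
    using N by (simp add: u_def field_simps power2_eq_square)
  then have "real (card X) \<le> real (8 * (card K)\<^sup>2)" by simp
  then show ?thesis by (simp only: of_nat_le_iff)
qed simp

section \<open>Sylvester's Hadamard matrices\<close>

text \<open>The entry is -1 to the number of common 1 bits among the lowest \<open>k\<close> bits of
  \<open>i\<close> and \<open>j\<close>. The recursion strips the lowest bit, so that sums split by
  parity.\<close>

fun hadamard :: "nat \<Rightarrow> nat \<Rightarrow> nat \<Rightarrow> real" where
  "hadamard 0 i j = 1"
| "hadamard (Suc k) i j = (if odd i \<and> odd j then -1 else 1) * hadamard k (i div 2) (j div 2)"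

lemma abs_hadamard [simp]: "\<bar>hadamard k i j\<bar> = 1"
  by (induction k arbitrary: i j) (auto simp: abs_mult)

lemma sum_lessThan_double:
  fixes F :: "nat \<Rightarrow> real"
  shows "(\<Sum>i<2 * m. F i) = (\<Sum>i<m. F (2 * i) + F (2 * i + 1))"
  by (induction m) auto

text \<open>Summing over the lowest bit of \<open>i\<close> leaves the factor
  \<open>1 + s x * s y\<close>. It vanishes if \<open>x\<close> and \<open>y\<close> differ in
  parity, as they must when their higher bits agree; if the higher bits differ, induction
  applies.\<close>

lemma hadamard_orthogonal:
  assumes "x < 2 ^ k" "y < 2 ^ k" "x \<noteq> y"
  shows "(\<Sum>i<2 ^ k. hadamard k i x * hadamard k i y) = 0"
  using assms
proof (induction k arbitrary: x y)
  case (Suc k)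
  define s where "s z = (if odd z then -1 else 1 :: real)" for z :: nat
  have "(\<Sum>i<2 ^ Suc k. hadamard (Suc k) i x * hadamard (Suc k) i y) =
      (\<Sum>i<2 ^ k. (1 + s x * s y) * (hadamard k i (x div 2) * hadamard k i (y div 2)))"
    unfolding power_Suc sum_lessThan_double
    by (intro sum.cong refl) (simp add: s_def algebra_simps)
  also have "\<dots> = (1 + s x * s y) * (\<Sum>i<2 ^ k. hadamard k i (x div 2) * hadamard k i (y div 2))"
    by (simp add: sum_distrib_left)
  also have "\<dots> = 0"
  proof (cases "x div 2 = y div 2")
    case True
    then have "odd x \<noteq> odd y" using \<open>x \<noteq> y\<close> by presburger
    then show ?thesis by (auto simp: s_def)
  next
    case False
    moreover have "x div 2 < 2 ^ k" "y div 2 < 2 ^ k" using Suc.prems by auto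
    ultimately show ?thesis using Suc.IH by simp
  qed
  finally show ?case .
qed simp

section \<open>Rank factorization of a matrix\<close>

text \<open>\<open>S\<close> is a maximal independent set of columns: a column outside its span
  could be added to it. Indexing by \<open>S\<close> itself matches the index set \<open>K\<close>
  of the sign rank bound.\<close>

lemma (in vec_space) rank_factorization:
  assumes A: "A \<in> carrier_mat n m"
  obtains S c where "finite S" "card S = rank A"
    "\<And>i j. i < n \<Longrightarrow> j < m \<Longrightarrow> A $$ (i, j) = (\<Sum>v\<in>S. v $ i * c j v)"
proof -
  have cols: "set (cols A) \<subseteq> carrier_vec n" using cols_dim A by blast
  have "lin_indpt {}" by (simp add: lin_dep_def)
  then obtain S where S: "finite S" "maximal S (\<lambda>T. T \<subseteq> set (cols A) \<and> lin_indpt T)"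
    using maximal_exists_superset[of "set (cols A)" "\<lambda>T. T \<subseteq> set (cols A) \<and> lin_indpt T" "{}"] by auto
  then have S_sub: "S \<subseteq> set (cols A)" and S_ind: "lin_indpt S" by (auto simp: maximal_def)
  have S_carrier: "S \<subseteq> carrier_vec n" using S_sub cols by blast
  have in_span: "v \<in> span S" if v: "v \<in> set (cols A)" for v
  proof (rule ccontr)
    assume nv: "v \<notin> span S"
    then have "v \<notin> S" using S_carrier span_mem by auto
    moreover have "lin_indpt (S \<union> {v})"
      using lin_dep_iff_in_span[of S v] S_carrier S_ind v cols nv \<open>v \<notin> S\<close> by auto
    ultimately show False
      using S(2) S_sub v unfolding maximal_def
      by (metis Un_insert_right insertI1 insert_subset subset_insertI sup_bot.right_neutral)
  qed
  have "\<exists>c. col A j = lincomb c S" if "j < m" for j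
  proof -
    have "col A j \<in> set (cols A)" using that A by (auto simp: cols_def)
    then show ?thesis using in_span finite_span[OF S(1)] S_carrier by auto
  qed
  then obtain c where c: "\<And>j. j < m \<Longrightarrow> col A j = lincomb (c j) S" by metis
  have "A $$ (i, j) = (\<Sum>v\<in>S. v $ i * c j v)" if "i < n" "j < m" for i j
  proof -
    have "A $$ (i, j) = col A j $ i" using that A by simp
    also have "\<dots> = (\<Sum>v\<in>S. c j v * v $ i)"
      using c that lincomb_index[OF _ S_carrier] by simp
    finally show ?thesis by (simp add: mult.commute)
  qed
  then show ?thesis using that[OF S(1)] rank_card_indpt[OF A S(2)] by simp
qed

section \<open>The data set of 2x2 blocks and its rationalizations\<close>

definition block_pair :: "nat \<Rightarrow> nat set" where
  "block_pair a = {2 * (a div 2), 2 * (a div 2) + 1}"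

text \<open>Equal parities form the diagonal of a block. Moving one coordinate to its partner flips
  the status, so the targets of a block never compete with each other.\<close>

definition is_target :: "(nat \<Rightarrow> nat \<Rightarrow> real) \<Rightarrow> nat \<Rightarrow> nat \<Rightarrow> bool" where
  "is_target H a b \<longleftrightarrow> (H (a div 2) (b div 2) = 1 \<longleftrightarrow> (even a \<longleftrightarrow> even b))"

definition block_data :: "nat \<Rightarrow> (nat \<Rightarrow> nat \<Rightarrow> real) \<Rightarrow> observation set" where
  "block_data N H = {((a, b), (block_pair a, block_pair b)) | a b.
     a < 2 * N \<and> b < 2 * N \<and> is_target H a b}"

lemma block_pair_cases: "a' \<in> block_pair a \<Longrightarrow> a' \<noteq> a \<Longrightarrow> a' div 2 = a div 2 \<and> even a' \<noteq> even a"
  by (auto simp: block_pair_def)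

lemma mem_block_pair: "a \<in> block_pair a"
  unfolding block_pair_def by (cases "even a") auto

lemma block_pair_subset: "a < 2 * N \<Longrightarrow> block_pair a \<subseteq> {..<2 * N}"
  unfolding block_pair_def by auto presburger

lemma is_data_set_block_data:
  assumes "2 * N \<le> n"
  shows "is_data_set n (block_data N H)"
  using assms block_pair_subset[of _ N] mem_block_pair
  unfolding is_data_set_def block_data_def by fastforce

text \<open>The witness is a common-interest game in which both players receive the indicator of the
  targets: every deviation inside a block leaves the targets.\<close>

lemma rationalizable_block_data:
  assumes "2 * N \<le> n"
  shows "rationalizable n (block_data N H)"
proof -
  define A :: "real mat" where "A = mat n n (\<lambda>(a, b). if is_target H a b then 1 else 0)"
  have "strict_nash A A (a, b) (block_pair a, block_pair b)"
    if "a < 2 * N" "b < 2 * N" "is_target H a b" for a b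
  proof -
    have "a' < n" if "a' \<in> block_pair a" for a'
      using that block_pair_subset[of a N] \<open>a < 2 * N\<close> assms by auto
    moreover have "b' < n" if "b' \<in> block_pair b" for b'
      using that block_pair_subset[of b N] \<open>b < 2 * N\<close> assms by auto
    moreover have "\<not> is_target H a' b" if "a' \<in> block_pair a - {a}" for a'
      using block_pair_cases[of a' a] that \<open>is_target H a b\<close> by (auto simp: is_target_def)
    moreover have "\<not> is_target H a b'" if "b' \<in> block_pair b - {b}" for b'
      using block_pair_cases[of b' b] that \<open>is_target H a b\<close> by (auto simp: is_target_def)
    ultimately show ?thesis
      using that assms by (auto simp: strict_nash_def A_def mem_block_pair)
  qed
  then have "rationalizes A A (block_data N H)"
    by (auto simp: rationalizes_def block_data_def)
  then show ?thesis
    unfolding rationalizable_def is_bimatrix_game_def by (intro exI[of _ A]) (auto simp: A_def)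
qed

text \<open>Each block has two equilibria. Adding one player's two deviation inequalities already
  fixes the sign of the mixed difference of that player's matrix; the signs for \<open>A\<close> and
  \<open>B\<close> agree, so \<open>A + B\<close> inherits them.\<close>

lemma block_data_mixed_difference:
  fixes A B :: "real mat"
  assumes rat: "rationalizes A B (block_data N H)" and n: "2 * N \<le> n"
    and AB: "A \<in> carrier_mat n n" "B \<in> carrier_mat n n"
    and ij: "i < N" "j < N" and H: "\<bar>H i j\<bar> = 1"
  defines "C \<equiv> A + B"
  shows "0 < H i j * (C $$ (2*i, 2*j) - C $$ (2*i, 2*j+1) - C $$ (2*i+1, 2*j) + C $$ (2*i+1, 2*j+1))"
proof -
  have nash: "strict_nash A B (a, b) ({2*i, 2*i+1}, {2*j, 2*j+1})"
    if "is_target H a b" "a div 2 = i" "b div 2 = j" for a b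
  proof -
    have "a < 2 * N" "b < 2 * N" using that ij by auto
    then have "((a, b), ({2*i, 2*i+1}, {2*j, 2*j+1})) \<in> block_data N H"
      using that by (auto simp: block_data_def block_pair_def)
    then show ?thesis using rat by (auto simp: rationalizes_def)
  qed
  have C: "C $$ (a, b) = A $$ (a, b) + B $$ (a, b)" if "a < 2 * N" "b < 2 * N" for a b
    using that AB n by (simp add: C_def)
  consider "H i j = 1" | "H i j = -1" using H by linarith
  then show ?thesis
  proof cases
    case 1
    then have "strict_nash A B (2*i, 2*j) ({2*i, 2*i+1}, {2*j, 2*j+1})"
      "strict_nash A B (2*i+1, 2*j+1) ({2*i, 2*i+1}, {2*j, 2*j+1})"
      using nash[of "2*i" "2*j"] nash[of "2*i+1" "2*j+1"] by (simp_all add: is_target_def)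
    then show ?thesis using 1 ij by (simp add: strict_nash_def C insert_Diff_if)
  next
    case 2
    then have "strict_nash A B (2*i, 2*j+1) ({2*i, 2*i+1}, {2*j, 2*j+1})"
      "strict_nash A B (2*i+1, 2*j) ({2*i, 2*i+1}, {2*j, 2*j+1})"
      using nash[of "2*i" "2*j+1"] nash[of "2*i+1" "2*j"] by (simp_all add: is_target_def)
    then show ?thesis using 2 ij by (simp add: strict_nash_def C insert_Diff_if)
  qed
qed

text \<open>Mixed differences of a sum of products are sums of products of differences. A
  factorization of \<open>A + B\<close> over \<open>S\<close> thus yields one of the difference
  matrix over the same \<open>S\<close>.\<close>

lemma game_rank_block_data:
  assumes rat: "rationalizes A B (block_data (2 ^ k) (hadamard k))" and n: "2 * 2 ^ k \<le> n"
    and AB: "is_bimatrix_game n A B"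
  shows "2 ^ k \<le> 8 * (game_rank n A B)\<^sup>2"
proof -
  interpret vec_space "TYPE(real)" n .
  have AB': "A \<in> carrier_mat n n" "B \<in> carrier_mat n n" using AB by (auto simp: is_bimatrix_game_def)
  then have AB_carrier: "A + B \<in> carrier_mat n n" by simp
  obtain S c where S: "finite S" "card S = rank (A + B)"
    and C: "\<And>i j. i < n \<Longrightarrow> j < n \<Longrightarrow> (A + B) $$ (i, j) = (\<Sum>v\<in>S. v $ i * c j v)"
    by (rule rank_factorization[OF AB_carrier]) blast
  have "card {..<2 ^ k :: nat} \<le> 8 * (card S)\<^sup>2"
  proof (rule sign_rank_bound[OF S(1)])
    fix i j :: nat assume "i \<in> {..<2 ^ k}" "j \<in> {..<2 ^ k}"
    then have ij: "i < 2 ^ k" "j < 2 ^ k" by auto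
    have lt: "2*i < n" "2*i+1 < n" "2*j < n" "2*j+1 < n" using ij n by auto
    have "(\<Sum>v\<in>S. (v $ (2*i) - v $ (2*i+1)) * (c (2*j) v - c (2*j+1) v)) =
      (A+B) $$ (2*i, 2*j) - (A+B) $$ (2*i, 2*j+1) - (A+B) $$ (2*i+1, 2*j) + (A+B) $$ (2*i+1, 2*j+1)"
      unfolding C[OF lt(1,3)] C[OF lt(1,4)] C[OF lt(2,3)] C[OF lt(2,4)]
      by (simp add: algebra_simps sum.distrib sum_subtractf)
    then show "0 < hadamard k i j * (\<Sum>v\<in>S. (v $ (2*i) - v $ (2*i+1)) * (c (2*j) v - c (2*j+1) v))"
      using block_data_mixed_difference[OF rat n AB' ij] by simp
  next
    fix x y :: nat assume "x \<in> {..<2 ^ k}" "y \<in> {..<2 ^ k}" "x \<noteq> y"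
    then show "(\<Sum>i<2 ^ k. hadamard k i x * hadamard k i y) = 0"
      by (intro hadamard_orthogonal) simp_all
  qed (simp_all add: lessThan_empty_iff)
  then show ?thesis by (simp add: game_rank_def S)
qed

section \<open>The square root bound for all large sizes\<close>

theorem theorem1:
  shows "\<exists>(c::real) (n0::nat). c > 0 \<and>
    (\<forall>n \<ge> n0. \<exists>T. is_data_set n T \<and> rationalizable n T \<and>
      (\<forall>A B. is_bimatrix_game n A B \<longrightarrow> rationalizes A B T \<longrightarrow>
        real (game_rank n A B) \<ge> c * sqrt (real n)))"
proof (intro exI[of _ "1/6 :: real"] exI[of _ "2 :: nat"] conjI allI impI)
  fix n :: nat assume "2 \<le> n"
  then have "1 \<le> n div 2" by simp
  \<comment> \<open>The largest block count \<open>2 ^ k\<close> that fits; \<open>n0 = 2\<close>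
    guarantees that one block does.\<close>
  then obtain k where k: "2 ^ k \<le> n div 2" "n div 2 < 2 ^ (k + 1)"
    using ex_power_ivl1[of 2 "n div 2"] by blast
  have n: "2 * 2 ^ k \<le> n" "n < 4 * 2 ^ k" using k by auto
  show "\<exists>T. is_data_set n T \<and> rationalizable n T \<and>
      (\<forall>A B. is_bimatrix_game n A B \<longrightarrow> rationalizes A B T \<longrightarrow>
        real (game_rank n A B) \<ge> 1/6 * sqrt (real n))"
  proof (intro exI[of _ "block_data (2 ^ k) (hadamard k)"] conjI allI impI)
    fix A B assume "is_bimatrix_game n A B" "rationalizes A B (block_data (2 ^ k) (hadamard k))"
    then have "2 ^ k \<le> 8 * (game_rank n A B)\<^sup>2" using game_rank_block_data n by blast
    \<comment> \<open>The estimates give \<open>n < 4 * 2 ^ k\<close> and hence the factor 32,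
      enlarged to the square 36; this is the source of the constant 1/6.\<close>
    then have "n \<le> 36 * (game_rank n A B)\<^sup>2" using n by linarith
    then have "real n \<le> real (36 * (game_rank n A B)\<^sup>2)" by (simp only: of_nat_le_iff)
    then have "real n \<le> (6 * real (game_rank n A B))\<^sup>2" by (simp add: power_mult_distrib)
    then have "sqrt (real n) \<le> 6 * real (game_rank n A B)" by (intro real_le_lsqrt) auto
    then show "1/6 * sqrt (real n) \<le> real (game_rank n A B)" by simp
  qed (use n is_data_set_block_data rationalizable_block_data in auto)
qed simp

end
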